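(* Let $f_1(x,y)$ and $f_2(x,y)$ be two relatively prime real cubic polynomials with exactly nine distinct real common zeros in $\mathbb R^2$, let $A$ be a set of eight of these zeros, and let $g\in I_{2,6}(A)\smallsetminus I_{1,3}^2(A)$. Let $F_1,F_2$ (of degree $3$) and $G$ (of degree $6$) be the homogenizations of $f_1,f_2,g$, and suppose $$P=c_1F_1^2+2c_2F_1F_2+c_3F_2^2+c_4G$$ with $c_1,c_2,c_3,c_4\in\mathbb R$. If $P$ is sos, then $c_4=0$. If $c_4=0$, then $P$ is sos if and only if $P$ is psd if and only if $c_1\ge0$, $c_3\ge0$ and $c_1c_3\ge c_2^2$.
   Context: A form is psd if it is nonnegative on all real points, and sos if it is a finite sum of squares of real forms. For a finite set $A\subset\mathbb R^2$: $I_{1,3}(A)$ is the space of real polynomials in $x,y$ of degree $\le3$ vanishing on $A$; $I_{2,6}(A)$ is the space of real polynomials of degree $\le6$ vanishing together with both first partial derivatives at each point of $A$; $I_{1,3}^2(A)$ is the set of finite sums $\sum_ih_ik_i$ with $h_i,k_i\in I_{1,3}(A)$. Homogenizations: $F_i=z^3f_i(x/z,y/z)$, $G=z^6g(x/z,y/z)$. *)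

theory Defs
  imports "HOL-Computational_Algebra.Computational_Algebra"
begin

text \<open>
  Encoding.  A polynomial in \<open>x, y\<close> is a \<open>real poly poly\<close> whose outer variable is \<open>y\<close>:
  the coefficient of \<open>x\<^sup>i y\<^sup>j\<close> is \<open>coeff (coeff f j) i\<close>.
  A polynomial in \<open>x, y, z\<close> is a \<open>real poly poly poly\<close> whose outermost variable is \<open>z\<close>:
  the coefficient of \<open>x\<^sup>i y\<^sup>j z\<^sup>k\<close> is \<open>coeff (coeff (coeff F k) j) i\<close>.
\<close>

type_synonym poly_xy = "real poly poly"
type_synonym poly_xyz = "real poly poly poly"

definition eval2 :: "poly_xy \<Rightarrow> real \<Rightarrow> real \<Rightarrow> real" where
  "eval2 f a b = poly (poly f [:b:]) a"

definition eval3 :: "poly_xyz \<Rightarrow> real \<Rightarrow> real \<Rightarrow> real \<Rightarrow> real" where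
  "eval3 F a b c = eval2 (poly F [:[:c:]:]) a b"

definition partial_x :: "poly_xy \<Rightarrow> poly_xy" where
  "partial_x f = map_poly pderiv f"

definition partial_y :: "poly_xy \<Rightarrow> poly_xy" where
  "partial_y f = pderiv f"

text \<open>The zero polynomial gets total degree \<open>0\<close>.\<close>

definition total_degree :: "poly_xy \<Rightarrow> nat" where
  "total_degree f = Max (insert 0 {i + j |i j. coeff (coeff f j) i \<noteq> 0})"

definition I13 :: "(real \<times> real) set \<Rightarrow> poly_xy set" where
  "I13 A = {f. total_degree f \<le> 3 \<and> (\<forall>(a, b)\<in>A. eval2 f a b = 0)}"

definition I26 :: "(real \<times> real) set \<Rightarrow> poly_xy set" where
  "I26 A = {f. total_degree f \<le> 6 \<and>
     (\<forall>(a, b)\<in>A. eval2 f a b = 0 \<and> eval2 (partial_x f) a b = 0 \<and> eval2 (partial_y f) a b = 0)}"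

definition I13_squared :: "(real \<times> real) set \<Rightarrow> poly_xy set" where
  "I13_squared A = {\<Sum>i<n. h i * k i |(n::nat) h k. \<forall>i<n. h i \<in> I13 A \<and> k i \<in> I13 A}"

text \<open>
  \<open>homogenize d f\<close> is \<open>z\<^sup>d f(x/z, y/z)\<close>; it is meant for \<open>total_degree f \<le> d\<close>
  (monomials of higher degree would be dropped).
\<close>

definition homogenize :: "nat \<Rightarrow> poly_xy \<Rightarrow> poly_xyz" where
  "homogenize d f =
     (\<Sum>(i, j)\<in>{(i, j). i + j \<le> d}. monom (monom (monom (coeff (coeff f j) i) i) j) (d - i - j))"

definition homogeneous :: "nat \<Rightarrow> poly_xyz \<Rightarrow> bool" where
  "homogeneous d F \<longleftrightarrow> (\<forall>i j k. coeff (coeff (coeff F k) j) i \<noteq> 0 \<longrightarrow> i + j + k = d)"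

definition is_form :: "poly_xyz \<Rightarrow> bool" where
  "is_form F \<longleftrightarrow> (\<exists>d. homogeneous d F)"

definition psd :: "poly_xyz \<Rightarrow> bool" where
  "psd F \<longleftrightarrow> (\<forall>a b c. eval3 F a b c \<ge> 0)"

definition sos :: "poly_xyz \<Rightarrow> bool" where
  "sos F \<longleftrightarrow> (\<exists>(n::nat) H. (\<forall>i<n. is_form (H i)) \<and> F = (\<Sum>i<n. (H i)\<^sup>2))"

definition const3 :: "real \<Rightarrow> poly_xyz" where
  "const3 c = [:[:[:c:]:]:]"

lemma eval2_add: "eval2 (f + g) a b = eval2 f a b + eval2 g a b"
  by (simp add: eval2_def)

lemma eval2_sum: "eval2 (sum f S) a b = (\<Sum>s\<in>S. eval2 (f s) a b)"
  by (induction S rule: infinite_finite_induct) (auto simp: eval2_add, simp_all add: eval2_def)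

lemma eval3_sum: "eval3 (sum F S) a b c = (\<Sum>s\<in>S. eval3 (F s) a b c)"
  by (simp add: eval3_def poly_sum eval2_sum)

lemma eval2_monom: "eval2 (monom (monom r i) j) a b = r * a ^ i * b ^ j"
  by (simp add: eval2_def poly_monom)

lemma eval3_monom: "eval3 (monom (monom (monom r i) j) k) a b c = r * a ^ i * b ^ j * c ^ k"
  by (simp add: eval3_def eval2_def poly_monom)

lemma coeff_total_degree:
  assumes "coeff (coeff f j) i \<noteq> 0"
  shows "i + j \<le> total_degree f"
proof -
  have "{i + j |i j. coeff (coeff f j) i \<noteq> 0}
      \<subseteq> (\<lambda>(i, j). i + j) ` (\<Union>j\<in>{..degree f}. {..degree (coeff f j)} \<times> {j})"
  proof clarify
    fix i j assume "coeff (coeff f j) i \<noteq> 0"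
    then have "j \<le> degree f" "i \<le> degree (coeff f j)"
      by (auto intro: le_degree)
    then show "i + j \<in> (\<lambda>(i, j). i + j) ` (\<Union>j\<in>{..degree f}. {..degree (coeff f j)} \<times> {j})"
      by force
  qed
  then have "finite {i + j |i j. coeff (coeff f j) i \<noteq> 0}"
    by (rule finite_subset) auto
  with assms show ?thesis
    unfolding total_degree_def by (intro Max_ge) auto
qed

lemma finite_exponents: "finite {(i, j). i + j \<le> (d::nat)}"
  by (rule finite_subset[of _ "{..d} \<times> {..d}"]) auto

lemma poly_xy_as_sum:
  assumes "total_degree f \<le> d"
  shows "f = (\<Sum>(i, j)\<in>{(i, j). i + j \<le> d}. monom (monom (coeff (coeff f j) i) i) j)"
proof (intro poly_eqI)
  fix q p
  have "coeff (coeff (\<Sum>(i, j)\<in>{(i, j). i + j \<le> d}. monom (monom (coeff (coeff f j) i) i) j) q) p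
      = (\<Sum>s\<in>{(i, j). i + j \<le> d}. if s = (p, q) then coeff (coeff f q) p else 0)"
    by (auto simp: coeff_sum intro!: sum.cong)
  also have "\<dots> = coeff (coeff f q) p"
  proof (cases "p + q \<le> d")
    case True
    then show ?thesis by (simp add: sum.delta finite_exponents)
  next
    case False
    then have "coeff (coeff f q) p = 0"
      using coeff_total_degree[of f q p] assms by force
    then show ?thesis by (simp add: sum.delta finite_exponents)
  qed
  finally show "coeff (coeff f q) p = coeff (coeff
      (\<Sum>(i, j)\<in>{(i, j). i + j \<le> d}. monom (monom (coeff (coeff f j) i) i) j) q) p" by simp
qed

lemma eval3_homogenize:
  assumes "total_degree f \<le> d" "c \<noteq> 0"
  shows "eval3 (homogenize d f) a b c = c ^ d * eval2 f (a / c) (b / c)"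
proof -
  have "eval2 f (a / c) (b / c)
      = (\<Sum>(i, j)\<in>{(i, j). i + j \<le> d}. coeff (coeff f j) i * (a / c) ^ i * (b / c) ^ j)"
    by (subst poly_xy_as_sum[OF assms(1)])
       (auto simp: eval2_sum eval2_monom intro!: sum.cong)
  moreover have "c ^ d * (r * (a / c) ^ i * (b / c) ^ j) = r * a ^ i * b ^ j * c ^ (d - i - j)"
    if "i + j \<le> d" for i j r
  proof -
    have "c ^ d = c ^ i * c ^ j * c ^ (d - i - j)"
      using that by (simp flip: power_add)
    then show ?thesis using assms(2) by (simp add: power_divide)
  qed
  ultimately show ?thesis
    by (simp only: homogenize_def eval3_sum sum_distrib_left)
       (rule sum.cong, auto simp only: eval3_monom mem_Collect_eq split: prod.split)
qed

end

theory Submission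
  imports Defs
begin

text \<open>
  If \<open>P\<close> is a sum of squares, then setting \<open>z = 1\<close> makes every summand the square of a cubic
  vanishing on \<open>A\<close>, so \<open>c4 g\<close> is a difference of elements of \<open>I13_squared A\<close>.

  If \<open>c4 = 0\<close> and \<open>P\<close> is psd, suppose that the binary form \<open>q = c1 s\<^sup>2 + 2 c2 s t + c3 t\<^sup>2\<close> takes
  a negative value at \<open>(s, t)\<close>.  Wherever \<open>t f1 - s f2\<close> vanishes, \<open>(f1, f2)\<close> is a multiple
  \<open>\<lambda> (s, t)\<close>, and \<open>\<lambda>\<^sup>2 q(s, t) \<ge> 0\<close> forces \<open>\<lambda> = 0\<close>; so this polynomial vanishes only at the
  finitely many common zeros.  After perturbing \<open>(s, t)\<close> it has degree exactly \<open>3\<close>, and an odd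
  degree polynomial has a zero on each of infinitely many parallel lines.
\<close>

section \<open>Evaluation as a ring homomorphism that separates polynomials\<close>

lemma eval2_mult: "eval2 (f * g) a b = eval2 f a b * eval2 g a b"
  by (simp add: eval2_def)

lemma eval2_power: "eval2 (f ^ n) a b = eval2 f a b ^ n"
  by (simp add: eval2_def)

lemma eval2_diff: "eval2 (f - g) a b = eval2 f a b - eval2 g a b"
  by (simp add: eval2_def)

lemma eval2_const: "eval2 [:[:c:]:] a b = c"
  by (simp add: eval2_def)

lemma eval3_add: "eval3 (F + G) a b c = eval3 F a b c + eval3 G a b c"
  by (simp add: eval3_def eval2_add)

lemma eval3_mult: "eval3 (F * G) a b c = eval3 F a b c * eval3 G a b c"
  by (simp add: eval3_def eval2_mult)

lemma eval3_power: "eval3 (F ^ n) a b c = eval3 F a b c ^ n"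
  by (simp add: eval3_def eval2_power)

lemma eval3_numeral: "eval3 (numeral n) a b c = numeral n"
  by (simp add: eval3_def eval2_def)

lemma eval3_const3: "eval3 (const3 r) a b c = r"
  by (simp add: eval3_def const3_def eval2_const)

lemmas eval3_simps = eval3_add eval3_mult eval3_power eval3_numeral eval3_const3

text \<open>A nonzero polynomial over the domain \<open>real poly\<close> has finitely many roots
  there, but each of the infinitely many constants \<open>[:b:]\<close> would be one.\<close>

lemma eval2_eq_0_imp_eq_0:
  assumes "\<And>a b. eval2 f a b = 0"
  shows "f = 0"
proof (rule ccontr)
  assume "f \<noteq> 0"
  then have "finite {x. poly f x = 0}"
    by (rule poly_roots_finite)
  moreover have "poly f [:b:] = 0" for b
    using assms unfolding eval2_def by (metis poly_all_0_iff_0)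
  then have "range (\<lambda>b. [:b:]) \<subseteq> {x. poly f x = 0}"
    by auto
  ultimately have "finite (range (\<lambda>b::real. [:b:]))"
    by (rule rev_finite_subset)
  moreover have "inj (\<lambda>b::real. [:b:])"
    by (auto intro: injI)
  ultimately show False
    using finite_imageD infinite_UNIV_char_0 by blast
qed

text \<open>The same root count one level up; it supplies a point at which a nonzero form does not
  vanish.\<close>

lemma eval3_eq_0_imp_eq_0:
  assumes "\<And>a b c. eval3 F a b c = 0"
  shows "F = 0"
proof (rule ccontr)
  assume "F \<noteq> 0"
  then have "finite {x. poly F x = 0}"
    by (rule poly_roots_finite)
  moreover have "poly F [:[:c:]:] = 0" for c
    using assms unfolding eval3_def by (intro eval2_eq_0_imp_eq_0)
  then have "range (\<lambda>c. [:[:c:]:]) \<subseteq> {x. poly F x = 0}"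
    by auto
  ultimately have "finite (range (\<lambda>c::real. [:[:c:]:]))"
    by (rule rev_finite_subset)
  moreover have "inj (\<lambda>c::real. [:[:c:]:])"
    by (auto intro: injI)
  ultimately show False
    using finite_imageD infinite_UNIV_char_0 by blast
qed

section \<open>Bounds for the total degree\<close>

lemma total_degree_leI:
  assumes "\<And>i j. coeff (coeff f j) i \<noteq> 0 \<Longrightarrow> i + j \<le> d"
  shows "total_degree f \<le> d"
proof -
  have "{i + j |i j. coeff (coeff f j) i \<noteq> 0} \<subseteq> {..d}"
    using assms by auto
  then have "finite {i + j |i j. coeff (coeff f j) i \<noteq> 0}"
    by (rule finite_subset) auto
  then show ?thesis
    unfolding total_degree_def using assms by (subst Max_le_iff) auto
qed

text \<open>The hypothesis excludes the extra \<open>0\<close> inserted into the maximum, so the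
  maximum comes from an actual monomial.\<close>

lemma total_degree_attained:
  assumes "total_degree f \<noteq> 0"
  obtains i j where "coeff (coeff f j) i \<noteq> 0" "i + j = total_degree f"
proof -
  let ?D = "{i + j |i j. coeff (coeff f j) i \<noteq> 0}"
  have "?D \<subseteq> {..total_degree f}"
    by (auto intro: coeff_total_degree)
  then have "finite (insert 0 ?D)"
    by (auto intro: finite_subset)
  then have "total_degree f \<in> insert 0 ?D"
    unfolding total_degree_def by (rule Max_in) auto
  with assms that show thesis
    by auto
qed

lemma total_degree_smult_le: "total_degree ([:[:c:]:] * f) \<le> total_degree f"
  by (rule total_degree_leI) (auto intro: coeff_total_degree)

lemma total_degree_diff_le:
  assumes "total_degree f \<le> d" "total_degree g \<le> d"
  shows "total_degree (f - g) \<le> d"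
proof (rule total_degree_leI)
  fix i j assume "coeff (coeff (f - g) j) i \<noteq> 0"
  then have "coeff (coeff f j) i \<noteq> 0 \<or> coeff (coeff g j) i \<noteq> 0"
    by auto
  then show "i + j \<le> d"
    using assms coeff_total_degree order_trans by blast
qed

subsection \<open>Odd degree polynomials have infinitely many zeros\<close>

lemma poly_odd_degree_root:
  fixes p :: "real poly"
  assumes "odd (degree p)"
  shows "\<exists>x. poly p x = 0"
proof -
  have pos: "\<exists>x. poly p x = 0" if odd: "odd (degree p)" and lc: "lead_coeff p > 0" for p :: "real poly"
  proof -
    obtain n where n: "poly p x \<ge> lead_coeff p" if "x \<ge> n" for x
      using poly_pinfty_gt_lc[OF lc] by blast
    \<comment> \<open>Reflection: \<open>r\<close> is -p(-x). As the degree is odd, the two sign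
      changes cancel in the leading coefficient, so \<open>r\<close> is also eventually positive and
      \<open>p\<close> is negative far to the left.\<close>
    define r where "r = - pcompose p [:0, -1:]"
    have "degree r = degree p"
      by (simp add: r_def degree_pcompose)
    moreover have "lead_coeff r = lead_coeff p"
      using odd by (simp add: r_def lead_coeff_comp lead_coeff_minus)
    ultimately obtain m where m: "poly r x \<ge> lead_coeff p" if "x \<ge> m" for x
      using poly_pinfty_gt_lc[of r] lc by metis
    define M where "M = max 1 (max n m)"
    have "n \<le> M" "m \<le> M"
      by (simp_all add: M_def)
    then have "poly p M > 0" "poly p (- M) < 0"
      using n[of M] m[of M] lc by (simp_all add: r_def poly_pcompose)
    moreover have "- M < M"
      by (simp add: M_def)
    ultimately show ?thesis
      using poly_IVT_pos by blast
  qed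
  have "p \<noteq> 0"
    using assms by auto
  then consider "lead_coeff p > 0" | "lead_coeff p < 0"
    using leading_coeff_neq_0 linorder_neqE by blast
  then show ?thesis
  proof cases
    case 1
    then show ?thesis using pos assms by blast
  next
    case 2
    then show ?thesis using pos[of "- p"] assms by (simp add: lead_coeff_minus)
  qed
qed

text \<open>Links substitution of a polynomial for y with evaluation along the curve y = q(x);
  applied to lines.\<close>

lemma poly_poly_real: "poly (poly f q) a = eval2 f a (poly q a)"
  by (induction f) (simp_all add: eval2_def)

text \<open>With upper bounds in place of exact degrees, the only surviving term of the convolution
  is the one at index \<open>m\<close>.\<close>

lemma coeff_mult_degree_le:
  fixes p q :: "'a::comm_semiring_0 poly"
  assumes "degree p \<le> m" "degree q \<le> n"
  shows "coeff (p * q) (m + n) = coeff p m * coeff q n"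
proof -
  have "coeff p i * coeff q (m + n - i) = 0" if "i \<le> m + n" "i \<noteq> m" for i
  proof (cases "i < m")
    case True
    then have "coeff q (m + n - i) = 0"
      using assms by (intro coeff_eq_0) linarith
    then show ?thesis by simp
  next
    case False
    then have "coeff p i = 0"
      using assms that by (intro coeff_eq_0) linarith
    then show ?thesis by simp
  qed
  then have "coeff (p * q) (m + n) = (\<Sum>i\<le>m + n. if i = m then coeff p m * coeff q n else 0)"
    unfolding coeff_mult by (intro sum.cong) auto
  then show ?thesis
    by simp
qed

lemma coeff_linear_power:
  fixes b :: "'a::comm_semiring_1"
  shows "coeff ([:n, b:] ^ j) j = b ^ j"
proof (induction j)
  case (Suc j)
  have "degree ([:n, b:] ^ j) \<le> 1 * j" "degree [:n, b:] \<le> 1"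
    using degree_power_le[of "[:n, b:]" j] by (auto intro: order_trans)
  then show ?case
    using coeff_mult_degree_le[of "[:n, b:]" 1 "[:n, b:] ^ j" j] Suc by simp
qed simp

text \<open>The degree \<open>d\<close> part of \<open>f\<close>, dehomogenized by x = 1; its value
  at \<open>b\<close> is the value of that part in the direction (1, b).\<close>

definition top_form :: "nat \<Rightarrow> poly_xy \<Rightarrow> real poly" where
  "top_form d f = (\<Sum>j\<le>d. monom (coeff (coeff f j) (d - j)) j)"

lemma poly_top_form: "poly (top_form d f) b = (\<Sum>j\<le>d. coeff (coeff f j) (d - j) * b ^ j)"
  by (simp add: top_form_def poly_sum poly_monom)

lemma top_form_neq_0:
  assumes "total_degree f = d" "d > 0"
  shows "top_form d f \<noteq> 0"
proof -
  obtain i j where ij: "coeff (coeff f j) i \<noteq> 0" "i + j = d"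
    using assms by (metis total_degree_attained gr_implies_not0)
  then have "coeff (top_form d f) j = coeff (coeff f j) i"
    by (auto simp: top_form_def coeff_sum)
  with ij show ?thesis by auto
qed

text \<open>On the line y = n + b x, only monomials of total degree \<open>d\<close> reach
  \<open>x^d\<close>, and each contributes through the slope alone. The coefficient is therefore the
  same for all parallel lines.\<close>

lemma restriction_to_line:
  assumes "total_degree f \<le> d"
  shows "degree (poly f [:n, b:]) \<le> d" "coeff (poly f [:n, b:]) d = poly (top_form d f) b"
proof -
  have deg: "degree (coeff f j) \<le> d - j" for j
  proof (rule degree_le, intro allI impI)
    fix i assume "i > d - j"
    then show "coeff (coeff f j) i = 0"
      using coeff_total_degree[of f j i] assms by linarith
  qed
  have coeff0: "coeff f j = 0" if "j > d" for j
    using coeff_total_degree[of f j] assms that by (intro poly_eqI) force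
  have "poly f [:n, b:] = (\<Sum>j\<le>degree f. coeff f j * [:n, b:] ^ j)"
    by (rule poly_altdef)
  also have "\<dots> = (\<Sum>j\<le>d. coeff f j * [:n, b:] ^ j)"
    using coeff0 coeff_eq_0[of f]
    by (intro sum.mono_neutral_cong) (auto simp: not_le)
  finally have eq: "poly f [:n, b:] = (\<Sum>j\<le>d. coeff f j * [:n, b:] ^ j)" .
  have lin: "degree ([:n, b:] ^ j) \<le> j" for j
    using degree_power_le[of "[:n, b:]" j] by (auto split: if_splits)
  have "degree (coeff f j * [:n, b:] ^ j) \<le> d" if "j \<le> d" for j
    using degree_mult_le[of "coeff f j" "[:n, b:] ^ j"] deg[of j] lin[of j] that by linarith
  then show "degree (poly f [:n, b:]) \<le> d"
    unfolding eq by (intro degree_sum_le) auto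
  have "coeff (coeff f j * [:n, b:] ^ j) d = coeff (coeff f j) (d - j) * b ^ j" if "j \<le> d" for j
    using coeff_mult_degree_le[OF deg[of j] lin[of j]] that by (simp add: coeff_linear_power)
  then show "coeff (poly f [:n, b:]) d = poly (top_form d f) b"
    unfolding eq by (simp add: coeff_sum poly_top_form)
qed

text \<open>Each line of slope \<open>b\<close> carries a zero, and the intercept y - b x tells
  these zeros apart.\<close>

lemma infinite_zeros_odd_degree:
  assumes "total_degree f \<le> d" "odd d" "poly (top_form d f) b \<noteq> 0"
  shows "infinite {(x, y). eval2 f x y = 0}"
proof
  assume "finite {(x, y). eval2 f x y = 0}"
  then have "finite ((\<lambda>(x, y). y - b * x) ` {(x, y). eval2 f x y = 0})"
    by (rule finite_imageI)
  moreover have "n \<in> (\<lambda>(x, y). y - b * x) ` {(x, y). eval2 f x y = 0}" for n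
  proof -
    have "degree (poly f [:n, b:]) = d"
      using restriction_to_line[OF assms(1)] assms(3) by (metis le_degree order_antisym)
    then obtain x where "poly (poly f [:n, b:]) x = 0"
      using poly_odd_degree_root assms(2) by metis
    then have "eval2 f x (n + b * x) = 0"
      by (simp add: poly_poly_real algebra_simps)
    then show ?thesis
      by (intro image_eqI[of _ _ "(x, n + b * x)"]) auto
  qed
  then have "(\<lambda>(x, y). y - b * x) ` {(x, y). eval2 f x y = 0} = UNIV"
    by blast
  ultimately show False
    using infinite_UNIV_char_0[where 'a = real] by simp
qed

text \<open>Since \<open>f1\<close> has degree exactly \<open>d\<close>, its top form is nonzero at
  some \<open>b\<close>; so it is \<open>t\<close>, the multiplier of \<open>f1\<close>, that is
  perturbed.\<close>

lemma finite_common_zeros_imp_quadratic_form_nonneg: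
  fixes c1 c2 c3 s t :: real
  assumes "total_degree f1 = d" "total_degree f2 \<le> d" "odd d"
    and "finite {(a, b). eval2 f1 a b = 0 \<and> eval2 f2 a b = 0}"
    and nonneg: "\<And>a b. c1 * (eval2 f1 a b)\<^sup>2 + 2 * c2 * eval2 f1 a b * eval2 f2 a b
      + c3 * (eval2 f2 a b)\<^sup>2 \<ge> 0"
  shows "c1 * s\<^sup>2 + 2 * c2 * s * t + c3 * t\<^sup>2 \<ge> 0"
proof (rule ccontr)
  define q where "q s t = c1 * s\<^sup>2 + 2 * c2 * s * t + c3 * t\<^sup>2" for s t
  assume "\<not> ?thesis"
  then have neg: "q s t < 0"
    by (simp add: q_def)
  have "d > 0"
    using assms(3) by (cases d) auto
  then obtain b where b: "poly (top_form d f1) b \<noteq> 0"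
    using top_form_neq_0[OF assms(1)] poly_all_0_iff_0 by blast
  define u v where "u = poly (top_form d f1) b" and "v = poly (top_form d f2) b"
  obtain t' where neg': "q s t' < 0" and top: "t' * u - s * v \<noteq> 0"
  proof (cases "t * u - s * v = 0")
    case True
    \<comment> \<open>Negativity of \<open>q\<close> is an open condition, while the vanishing of t
      u - s v at a nonzero \<open>u\<close> fixes \<open>t\<close>; any nearby value other than
      \<open>t\<close> works.\<close>
    have "continuous (at t) (q s)"
      unfolding q_def by (intro continuous_intros)
    then have "\<forall>\<^sub>F x in at t. q s x < 0"
      using neg by (auto simp: continuous_at intro: order_tendstoD)
    then have "\<forall>\<^sub>F x in at t. q s x < 0 \<and> x \<noteq> t"
      by (simp add: eventually_conj_iff eventually_neq_at_within)
    from eventually_happens'[OF at_neq_bot this] obtain x where "q s x < 0" "x \<noteq> t"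
      by blast
    moreover have "x * u - s * v = (x - t) * u + (t * u - s * v)"
      by (simp add: algebra_simps)
    ultimately show thesis
      using that True b by (simp add: u_def)
  qed (use neg that in blast)
  define w where "w = [:[:t':]:] * f1 - [:[:s:]:] * f2"
  have "total_degree w \<le> d"
    unfolding w_def using assms(1,2) total_degree_smult_le[of _ f1] total_degree_smult_le[of _ f2]
    by (intro total_degree_diff_le) (auto intro: order_trans)
  moreover have "poly (top_form d w) b = t' * u - s * v"
    by (simp add: w_def u_def v_def poly_top_form sum_subtractf sum_distrib_left algebra_simps)
  ultimately have "infinite {(x, y). eval2 w x y = 0}"
    using top assms(3) infinite_zeros_odd_degree[of w d b] by simp
  moreover have "eval2 f1 x y = 0 \<and> eval2 f2 x y = 0" if "eval2 w x y = 0" for x y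
  proof -
    define z1 z2 where "z1 = eval2 f1 x y" and "z2 = eval2 f2 x y"
    have w0: "t' * z1 = s * z2"
      using that unfolding w_def z1_def z2_def eval2_diff eval2_mult eval2_const by simp
    have q0: "q z1 z2 \<ge> 0"
      using nonneg[of x y] by (simp add: q_def z1_def z2_def)
    \<comment> \<open>The relation \<open>w0\<close> makes \<open>(z1, z2)\<close> parallel to
      \<open>(s, t')\<close>; these identities express that without dividing by \<open>s\<close> or
      \<open>t'\<close>.\<close>
    have "s\<^sup>2 * q z1 z2 = z1\<^sup>2 * q s t'" "t'\<^sup>2 * q z1 z2 = z2\<^sup>2 * q s t'"
      using w0 unfolding q_def by algebra+
    then have "z1\<^sup>2 * q s t' \<ge> 0" "z2\<^sup>2 * q s t' \<ge> 0"
      using q0 by (metis mult_nonneg_nonneg zero_le_power2)+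
    then have "z1 = 0" "z2 = 0"
      using neg' by (simp_all add: zero_le_mult_iff)
    then show ?thesis
      by (simp add: z1_def z2_def)
  qed
  then have "{(x, y). eval2 w x y = 0} \<subseteq> {(a, b). eval2 f1 a b = 0 \<and> eval2 f2 a b = 0}"
    by auto
  ultimately show False
    using assms(4) finite_subset by blast
qed

section \<open>Nonnegative binary quadratic forms\<close>

lemma quadratic_form_nonneg_iff:
  fixes c1 c2 c3 :: real
  shows "(\<forall>s t. c1 * s\<^sup>2 + 2 * c2 * s * t + c3 * t\<^sup>2 \<ge> 0) \<longleftrightarrow> c1 \<ge> 0 \<and> c3 \<ge> 0 \<and> c1 * c3 \<ge> c2\<^sup>2"
    (is "?L \<longleftrightarrow> ?R")
proof
  assume L: "?L"
  have c1: "c1 \<ge> 0" using L[rule_format, of 1 0] by simp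
  have c3: "c3 \<ge> 0" using L[rule_format, of 0 1] by simp
  have "c1 * c3 \<ge> c2\<^sup>2"
  proof (cases "c1 = 0")
    case True
    have "c2 = 0"
    proof (rule ccontr)
      assume "c2 \<noteq> 0"
      \<comment> \<open>For \<open>c1 = 0\<close> the form is linear in \<open>s\<close> at
        \<open>t = 1\<close>; the chosen \<open>s\<close> gives it the value -1.\<close>
      then show False
        using L[rule_format, of "- (c3 + 1) / (2 * c2)" 1] True c3 by simp
    qed
    then show ?thesis using True by simp
  next
    case False
    \<comment> \<open>The point \<open>(c2, - c1)\<close> is where the completed square
      \<open>c1 * s + c2 * t\<close> vanishes, up to sign and order of its coefficients.\<close>
    have "c1 * (c1 * c3 - c2\<^sup>2) \<ge> 0"
      using L[rule_format, of c2 "- c1"] by (simp add: algebra_simps power2_eq_square)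
    then show ?thesis
      using False c1 by (simp add: zero_le_mult_iff)
  qed
  with c1 c3 show ?R by simp
next
  assume R: ?R
  show ?L
  proof (intro allI)
    fix s t
    show "c1 * s\<^sup>2 + 2 * c2 * s * t + c3 * t\<^sup>2 \<ge> 0"
    proof (cases "c1 = 0")
      case True
      then show ?thesis using R by simp
    next
      case False
      have "c1 * (c1 * s\<^sup>2 + 2 * c2 * s * t + c3 * t\<^sup>2) = (c1 * s + c2 * t)\<^sup>2 + (c1 * c3 - c2\<^sup>2) * t\<^sup>2"
        by (simp add: algebra_simps power2_eq_square)
      also have "\<dots> \<ge> 0"
        using R by simp
      finally show ?thesis
        using False R by (simp add: zero_le_mult_iff)
    qed
  qed
qed

subsection \<open>Forms\<close>

lemma eval3_altdef: "eval3 F a b c = (\<Sum>k\<le>degree F. \<Sum>j\<le>degree (coeff F k).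
    \<Sum>i\<le>degree (coeff (coeff F k) j). coeff (coeff (coeff F k) j) i * a ^ i * b ^ j * c ^ k)"
proof -
  have eval2: "eval2 f a b = (\<Sum>j\<le>degree f. \<Sum>i\<le>degree (coeff f j). coeff (coeff f j) i * a ^ i * b ^ j)"
    for f
    by (simp add: eval2_def poly_altdef[of f] poly_sum poly_altdef[of "coeff f _"] sum_distrib_right)
  have "eval3 F a b c = (\<Sum>k\<le>degree F. eval2 (coeff F k) a b * c ^ k)"
    by (simp add: eval3_def poly_altdef[of F] eval2_sum eval2_mult eval2_power eval2_const)
  then show ?thesis
    by (simp add: eval2 sum_distrib_right)
qed

lemma eval3_homogeneous:
  assumes "homogeneous d F"
  shows "eval3 F (t * a) (t * b) (t * c) = t ^ d * eval3 F a b c"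
proof -
  have "r * (t * a) ^ i * (t * b) ^ j * (t * c) ^ k = t ^ d * (r * a ^ i * b ^ j * c ^ k)"
    if "r = coeff (coeff (coeff F k) j) i" for r i j k
  proof (cases "r = 0")
    case False
    then have "d = i + j + k"
      using assms that by (auto simp: homogeneous_def)
    then show ?thesis
      by (simp add: power_mult_distrib power_add)
  qed simp
  then show ?thesis
    unfolding eval3_altdef sum_distrib_left by (intro sum.cong) auto
qed

lemma coeff_homogenize:
  "coeff (coeff (coeff (homogenize d f) k) j) i = (if i + j + k = d then coeff (coeff f j) i else 0)"
proof -
  have "coeff (coeff (coeff (homogenize d f) k) j) i =
      (\<Sum>s\<in>{(i, j). i + j \<le> d}. if s = (i, j) then (if i + j + k = d then coeff (coeff f j) i else 0) else 0)"
    unfolding homogenize_def coeff_sum by (intro sum.cong) (auto split: if_splits)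
  then show ?thesis
    by (auto simp: sum.delta finite_exponents)
qed

lemma homogeneous_homogenize: "homogeneous d (homogenize d f)"
  by (auto simp: homogeneous_def coeff_homogenize)

lemma homogeneous_add:
  assumes "homogeneous d F" "homogeneous d G"
  shows "homogeneous d (F + G)"
  using assms by (auto simp: homogeneous_def) (metis add_0)

lemma homogeneous_const3_mult: "homogeneous d F \<Longrightarrow> homogeneous d (const3 c * F)"
  by (auto simp: homogeneous_def const3_def)

lemma poly_homogenize_1:
  assumes "total_degree f \<le> d"
  shows "poly (homogenize d f) 1 = f"
  by (subst (2) poly_xy_as_sum[OF assms])
     (auto simp: homogenize_def poly_sum poly_monom intro!: sum.cong)

lemma total_degree_dehomogenize:
  assumes "homogeneous d F"
  shows "total_degree (poly F 1) \<le> d"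
proof (rule total_degree_leI)
  fix i j assume "coeff (coeff (poly F 1) j) i \<noteq> 0"
  then have "(\<Sum>k\<le>degree F. coeff (coeff (coeff F k) j) i) \<noteq> 0"
    by (simp add: poly_altdef coeff_sum)
  then obtain k where "coeff (coeff (coeff F k) j) i \<noteq> 0"
    by (metis sum.neutral)
  then show "i + j \<le> d"
    using assms by (force simp: homogeneous_def)
qed

text \<open>Being sos allows forms of different degrees. Along a line through the origin, both sides
  are polynomials in \<open>t\<close>; the coefficients coming from squares are nonnegative and
  cannot cancel, so no degree other than \<open>2 * d\<close> can occur.\<close>

lemma sos_summand_homogeneous:
  fixes n :: nat
  assumes P: "\<And>t a b c. eval3 P (t * a) (t * b) (t * c) = t ^ (2 * d) * eval3 P a b c"
    and sum: "P = (\<Sum>i<n. (H i)\<^sup>2)" and form: "\<And>i. i < n \<Longrightarrow> is_form (H i)" and m: "m < n"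
  shows "homogeneous d (H m)"
proof (cases "H m = 0")
  case True
  then show ?thesis by (simp add: homogeneous_def)
next
  case False
  then obtain a b c where nz: "eval3 (H m) a b c \<noteq> 0"
    using eval3_eq_0_imp_eq_0 by blast
  obtain e where e: "\<And>i. i < n \<Longrightarrow> homogeneous (e i) (H i)"
    using form unfolding is_form_def by metis
  define v where "v i = (eval3 (H i) a b c)\<^sup>2" for i
  have "poly (\<Sum>i<n. monom (v i) (2 * e i)) t = poly (monom (eval3 P a b c) (2 * d)) t" for t
  proof -
    have "t ^ (2 * d) * eval3 P a b c = (\<Sum>i<n. (eval3 (H i) (t * a) (t * b) (t * c))\<^sup>2)"
      using P[of t a b c] by (simp add: sum eval3_sum eval3_power)
    also have "\<dots> = (\<Sum>i<n. v i * t ^ (2 * e i))"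
      using eval3_homogeneous[OF e]
      by (intro sum.cong) (auto simp: v_def power_mult_distrib power_even_eq)
    finally show ?thesis
      by (simp add: poly_sum poly_monom mult.commute)
  qed
  then have eq: "(\<Sum>i<n. monom (v i) (2 * e i)) = monom (eval3 P a b c) (2 * d)"
    by (simp flip: poly_eq_poly_eq_iff add: fun_eq_iff)
  have "coeff (\<Sum>i<n. monom (v i) (2 * e i)) (2 * e m) = coeff (monom (eval3 P a b c) (2 * d)) (2 * e m)"
    using eq by (rule arg_cong)
  moreover have "coeff (\<Sum>i<n. monom (v i) (2 * e i)) (2 * e m) = (\<Sum>i<n. if e i = e m then v i else 0)"
    by (simp add: coeff_sum)
  \<comment> \<open>All terms are nonnegative, and the one at \<open>m\<close> is positive by the
    choice of the point.\<close>
  moreover have "\<dots> > 0"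
    using m nz by (intro sum_pos2[of _ m]) (auto simp: v_def)
  ultimately have "e m = d"
    by (auto split: if_splits)
  then show ?thesis
    using e[OF m] by simp
qed

lemma sos_imp_psd: "sos F \<Longrightarrow> psd F"
  by (auto simp: sos_def psd_def eval3_sum eval3_power intro!: sum_nonneg)

lemma const3_add: "const3 (a + b) = const3 a + const3 b"
  by (simp add: const3_def)

lemma const3_mult: "const3 (a * b) = const3 a * const3 b"
  by (simp add: const3_def)

text \<open>A Cholesky factorization writes the quadratic form as (p s + q t)^2 + (r t)^2; the two
  squares become the two forms \<open>H 0\<close> and \<open>H 1\<close>.\<close>

lemma sos_quadratic_form:
  assumes F: "homogeneous d F1" "homogeneous d F2"
    and c: "c1 \<ge> 0" "c3 \<ge> 0" "c1 * c3 \<ge> c2\<^sup>2"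
  shows "sos (const3 c1 * F1\<^sup>2 + 2 * const3 c2 * F1 * F2 + const3 c3 * F2\<^sup>2)"
proof -
  obtain p q r where pqr: "c1 = p\<^sup>2" "c2 = p * q" "c3 = q\<^sup>2 + r\<^sup>2"
  proof (cases "c1 = 0")
    case True
    \<comment> \<open>Here \<open>c2\<^sup>2 \<le> c1 * c3 = 0\<close>, so \<open>c2 = 0\<close> and
      only the square of \<open>t\<close> remains.\<close>
    then show thesis
      using that[of 0 0 "sqrt c3"] c by simp
  next
    case False
    then have "c1 > 0" using c by simp
    then have "c2\<^sup>2 / c1 \<le> c3"
      using c by (simp add: field_simps)
    with \<open>c1 > 0\<close> show thesis
      using that[of "sqrt c1" "c2 / sqrt c1" "sqrt (c3 - c2\<^sup>2 / c1)"] by (simp add: power_divide)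
  qed
  define H where "H i = (if i = 0 then const3 p * F1 + const3 q * F2 else const3 r * F2)" for i :: nat
  have "is_form (H i)" for i
    unfolding H_def is_form_def using F homogeneous_add homogeneous_const3_mult by (metis (full_types))
  moreover have "const3 c1 * F1\<^sup>2 + 2 * const3 c2 * F1 * F2 + const3 c3 * F2\<^sup>2 = (\<Sum>i<2. (H i)\<^sup>2)"
    by (simp add: numeral_2_eq_2 H_def)
       (simp add: pqr const3_mult const3_add power2_eq_square algebra_simps)
  ultimately show ?thesis
    unfolding sos_def by blast
qed

subsection \<open>The spaces of vanishing polynomials\<close>

lemma I13_scale: "f \<in> I13 A \<Longrightarrow> [:[:c:]:] * f \<in> I13 A"
  using total_degree_smult_le[of c f] by (force simp: I13_def eval2_mult simp del: mult_pCons_left)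

lemma I13_squaredI:
  fixes n :: nat
  shows "(\<And>i. i < n \<Longrightarrow> h i \<in> I13 A \<and> k i \<in> I13 A) \<Longrightarrow> (\<Sum>i<n. h i * k i) \<in> I13_squared A"
  by (auto simp: I13_squared_def)

lemma I13_squared_add_product:
  assumes "p \<in> I13_squared A" "h \<in> I13 A" "k \<in> I13 A"
  shows "p + h * k \<in> I13_squared A"
proof -
  obtain n :: nat and hs ks where p: "p = (\<Sum>i<n. hs i * ks i)"
    and mem: "\<forall>i<n. hs i \<in> I13 A \<and> ks i \<in> I13 A"
    using assms(1) by (auto simp: I13_squared_def)
  have eq: "p + h * k = (\<Sum>i<Suc n. (hs(n := h)) i * (ks(n := k)) i)"
    by (simp add: p)
  show ?thesis
    unfolding eq using mem assms by (intro I13_squaredI) (auto simp: less_Suc_eq)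
qed

lemma I13_squared_scale:
  assumes "p \<in> I13_squared A"
  shows "[:[:c:]:] * p \<in> I13_squared A"
proof -
  obtain n :: nat and h k where p: "p = (\<Sum>i<n. h i * k i)"
    and mem: "\<forall>i<n. h i \<in> I13 A \<and> k i \<in> I13 A"
    using assms by (auto simp: I13_squared_def)
  have eq: "[:[:c:]:] * p = (\<Sum>i<n. ([:[:c:]:] * h i) * k i)"
    unfolding p sum_distrib_left by (simp only: mult.assoc)
  show ?thesis
    unfolding eq using mem I13_scale by (intro I13_squaredI) blast
qed

text \<open>Real squares that sum to zero at a point of \<open>A\<close> all vanish there, so each
  \<open>h i\<close> lies in \<open>I13 A\<close>.\<close>

lemma sum_squares_in_I13_squared:
  fixes n :: nat
  assumes "\<And>i. i < n \<Longrightarrow> total_degree (h i) \<le> 3"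
    and "\<And>a b. (a, b) \<in> A \<Longrightarrow> eval2 (\<Sum>i<n. (h i)\<^sup>2) a b = 0"
  shows "(\<Sum>i<n. (h i)\<^sup>2) \<in> I13_squared A"
proof -
  have "h i \<in> I13 A" if "i < n" for i
  proof -
    have "eval2 (h i) a b = 0" if "(a, b) \<in> A" for a b
      using assms(2)[OF that] \<open>i < n\<close>
      by (simp add: eval2_sum eval2_power sum_nonneg_eq_0_iff)
    then show ?thesis
      using assms(1)[OF that] by (auto simp: I13_def)
  qed
  then show ?thesis
    unfolding power2_eq_square by (intro I13_squaredI) simp
qed

theorem theorem5p1:
  fixes f1 f2 g :: poly_xy
    and A :: "(real \<times> real) set"
    and F1 F2 G P :: poly_xyz
    and c1 c2 c3 c4 :: real
  assumes "total_degree f1 = 3" and "total_degree f2 = 3"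
    and "coprime f1 f2"
    and "card {(a, b). eval2 f1 a b = 0 \<and> eval2 f2 a b = 0} = 9"
    and "A \<subseteq> {(a, b). eval2 f1 a b = 0 \<and> eval2 f2 a b = 0}" and "card A = 8"
    and "g \<in> I26 A - I13_squared A"
    and "F1 = homogenize 3 f1" and "F2 = homogenize 3 f2" and "G = homogenize 6 g"
    and "P = const3 c1 * F1\<^sup>2 + 2 * const3 c2 * F1 * F2 + const3 c3 * F2\<^sup>2 + const3 c4 * G"
  shows "(sos P \<longrightarrow> c4 = 0) \<and>
    (c4 = 0 \<longrightarrow>
      (sos P \<longleftrightarrow> psd P) \<and>
      (psd P \<longleftrightarrow> c1 \<ge> 0 \<and> c3 \<ge> 0 \<and> c1 * c3 \<ge> c2\<^sup>2))"
proof -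
  have f: "f1 \<in> I13 A" "f2 \<in> I13 A"
    using assms(1,2,5) by (auto simp: I13_def)
  have g: "total_degree g \<le> 6" "\<And>a b. (a, b) \<in> A \<Longrightarrow> eval2 g a b = 0"
    using assms(7) by (auto simp: I26_def)
  have hom: "homogeneous 3 F1" "homogeneous 3 F2" "homogeneous 6 G"
    by (simp_all add: assms(8-10) homogeneous_homogenize)
  have at1: "poly F1 1 = f1" "poly F2 1 = f2" "poly G 1 = g"
    using assms(1,2) g by (simp_all add: assms(8-10) poly_homogenize_1)
  have P1: "poly P 1 = [:[:c1:]:] * f1\<^sup>2 + 2 * [:[:c2:]:] * f1 * f2 + [:[:c3:]:] * f2\<^sup>2 + [:[:c4:]:] * g"
    by (simp add: assms(11) const3_def at1)

  have "c4 = 0" if sos: "sos P"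
  proof (rule ccontr)
    assume c4: "c4 \<noteq> 0"
    obtain n :: nat and H where H: "\<And>i. i < n \<Longrightarrow> is_form (H i)" and P: "P = (\<Sum>i<n. (H i)\<^sup>2)"
      using sos by (auto simp: sos_def)
    \<comment> \<open>\<open>P\<close> scales with degree 6, which forces every summand to be the
      square of a cubic form.\<close>
    have "eval3 P (t * a) (t * b) (t * c) = t ^ (2 * 3) * eval3 P a b c" for t a b c
      unfolding assms(11) eval3_simps hom[THEN eval3_homogeneous]
      by (simp add: algebra_simps power_mult_distrib flip: power_mult power_add)
    then have "homogeneous 3 (H i)" if "i < n" for i
      using sos_summand_homogeneous P H that by blast
    then have "total_degree (poly (H i) 1) \<le> 3" if "i < n" for i
      using that total_degree_dehomogenize by blast
    moreover have eq: "poly P 1 = (\<Sum>i<n. (poly (H i) 1)\<^sup>2)"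
      by (simp add: P poly_sum)
    moreover have "eval2 (poly P 1) a b = 0" if "(a, b) \<in> A" for a b
      using that g(2) assms(5) unfolding P1 eval2_add eval2_mult eval2_power by auto
    ultimately have "poly P 1 \<in> I13_squared A"
      using sum_squares_in_I13_squared[of n "\<lambda>i. poly (H i) 1" A] by simp
    \<comment> \<open>The quadratic part in \<open>f1\<close> and \<open>f2\<close> is cancelled by
      adding products of elements of \<open>I13 A\<close>, which leaves only the multiple of
      \<open>g\<close>.\<close>
    then have "poly P 1 + ([:[:- c1:]:] * f1) * f1 + ([:[:- 2 * c2:]:] * f1) * f2 + ([:[:- c3:]:] * f2) * f2
        \<in> I13_squared A"
      by (intro I13_squared_add_product I13_scale f)
    also have "poly P 1 + ([:[:- c1:]:] * f1) * f1 + ([:[:- 2 * c2:]:] * f1) * f2 + ([:[:- c3:]:] * f2) * f2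
        = [:[:c4:]:] * g"
    proof -
      have "[:[:- c1:]:] = - [:[:c1:]:]" "[:[:- 2 * c2:]:] = - (2 * [:[:c2:]:])" "[:[:- c3:]:] = - [:[:c3:]:]"
        by (simp_all add: numeral_poly)
      then show ?thesis
        unfolding P1
        by (simp only: power2_eq_square ring_distribs mult_2 mult_minus_left minus_add_distrib mult.assoc)
    qed
    finally have "[:[:1 / c4:]:] * ([:[:c4:]:] * g) \<in> I13_squared A"
      by (rule I13_squared_scale)
    then have "g \<in> I13_squared A"
      using c4 by (simp flip: one_pCons)
    then show False
      using assms(7) by simp
  qed
  moreover have "c1 \<ge> 0 \<and> c3 \<ge> 0 \<and> c1 * c3 \<ge> c2\<^sup>2" if "c4 = 0" "psd P"
  proof -
    have nonneg: "c1 * (eval2 f1 a b)\<^sup>2 + 2 * c2 * eval2 f1 a b * eval2 f2 a b + c3 * (eval2 f2 a b)\<^sup>2 \<ge> 0"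
      for a b
    proof -
      \<comment> \<open>In the affine chart z = 1 the homogenizations become \<open>f1\<close> and
        \<open>f2\<close>.\<close>
      have "eval3 P a b 1 \<ge> 0"
        using that by (simp add: psd_def)
      then show ?thesis
        using assms(1,2) that by (simp add: assms(8,9,11) eval3_simps eval3_homogenize)
    qed
    \<comment> \<open>An infinite set has \<open>card\<close> equal to 0, so cardinality 9 gives
      finiteness.\<close>
    have fin: "finite {(a, b). eval2 f1 a b = 0 \<and> eval2 f2 a b = 0}"
      by (rule card_ge_0_finite) (simp add: assms(4))
    have "c1 * s\<^sup>2 + 2 * c2 * s * t + c3 * t\<^sup>2 \<ge> 0" for s t
      using finite_common_zeros_imp_quadratic_form_nonneg[OF assms(1) _ _ fin nonneg] assms(2) by simp
    then show ?thesis
      unfolding quadratic_form_nonneg_iff[symmetric] by blast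
  qed
  moreover have "sos P" if "c4 = 0" "c1 \<ge> 0 \<and> c3 \<ge> 0 \<and> c1 * c3 \<ge> c2\<^sup>2"
    using sos_quadratic_form[OF hom(1,2)] that by (simp add: assms(11) const3_def)
  \<comment> \<open>For \<open>c4 = 0\<close> the implications form a cycle: sos to psd, psd to the
    inequalities, and the inequalities back to sos.\<close>
  ultimately show ?thesis
    using sos_imp_psd by blast
qed

end
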